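(* Let $n,N\in\mathbb{N}$, let $1\le k<N$, and let $\boldsymbol{A}=(A(\alpha))_{\alpha\in\mathbb{Z}}$ be a univariate mask of real $n\times n$ matrices with $A(\alpha)=0$ for $\alpha\notin[0,N]$, for which a finitely supported difference mask $\boldsymbol{B}_k$ of real $n\times n$ matrices with $\nabla^kS_{\boldsymbol{A}}=S_{\boldsymbol{B}_k}\nabla^k$ exists. For $\varepsilon\in\{0,1\}$ let $A_\varepsilon|_{V_k}$ be the matrix of the operator $\mathcal{A}_\varepsilon|_{V_k}$ with respect to the basis of $V_k$ fixed in the context. Then for every $r\ge1$ $$\max_{\varepsilon_1,\dots,\varepsilon_r\in\{0,1\}}\Big\|\prod_{j=1}^rA_{\varepsilon_j}|_{V_k}\Big\|_\infty=\big\|S_{\boldsymbol{B}_k}^r|_{\nabla^k}\big\|_\infty,$$ where $\|\cdot\|_\infty$ on the left is the infinity matrix norm (maximal absolute row sum).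
   Context: Sequence spaces: $\ell^{n}(\mathbb{Z})$ is the space of all sequences $\mathbb{Z}\to\mathbb{R}^n$ (column vectors); $\ell^n_\infty(\mathbb{Z})$ is its subspace of bounded sequences with norm $\|\boldsymbol{c}\|_\infty=\sup_{\alpha\in\mathbb{Z}}|c(\alpha)|_\infty$, where $|\cdot|_\infty$ is the maximum norm on $\mathbb{R}^n$; $\ell_0^{1\times n}(\mathbb{Z})$ is the space of finitely supported sequences of row vectors. Intervals such as $[0,N]$ denote sets of integers. $e_j$ is the $j$-th standard unit vector of $\mathbb{R}^n$; $\boldsymbol{\delta}$ is the scalar sequence with $\delta(0)=1$ and $\delta(\alpha)=0$ for $\alpha\neq0$. Subdivision operator: for a finitely supported mask $\boldsymbol{M}$ of $n\times n$ matrices, $S_{\boldsymbol{M}}\boldsymbol{c}(\alpha)=\sum_{\beta\in\mathbb{Z}}M(\alpha-2\beta)c(\beta)$, $\alpha\in\mathbb{Z}$, $\boldsymbol{c}\in\ell^n(\mathbb{Z})$. Difference operator: let $\mathcal{E}_{\boldsymbol{A}}=\{v\in\mathbb{R}^n:\sum_{\alpha\in\mathbb{Z}}A(\varepsilon-2\alpha)v=v,\ \varepsilon\in\{0,1\}\}$ and $m=\dim\mathcal{E}_{\boldsymbol{A}}$. For $\boldsymbol{c}=(c_1,\dots,c_n)^T\in\ell^n(\mathbb{Z})$, the sequence $\nabla\boldsymbol{c}$ has components $-c_j+c_j(\cdot-1)$ for $1\le j\le m$ and $c_j$ for $m+1\le j\le n$; $\nabla^k$ is the $k$-fold iterate of $\nabla$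 (so the components $j>m$ are unchanged). Difference mask: $\boldsymbol{B}_k$ is a finitely supported mask of real $n\times n$ matrices with $\nabla^kS_{\boldsymbol{A}}\boldsymbol{c}=S_{\boldsymbol{B}_k}\nabla^k\boldsymbol{c}$ for all $\boldsymbol{c}\in\ell^n(\mathbb{Z})$. Restricted norm: $\|S_{\boldsymbol{B}_k}^r|_{\nabla^k}\|_\infty=\sup\{\|S_{\boldsymbol{B}_k}^r\nabla^k\boldsymbol{c}\|_\infty/\|\nabla^k\boldsymbol{c}\|_\infty:\ \boldsymbol{c}\in\ell^n_\infty(\mathbb{Z}),\ \nabla^k\boldsymbol{c}\neq0\}$. Operators $\mathcal{A}_\varepsilon$: for $\varepsilon\in\{0,1\}$ and $\boldsymbol{v}\in\ell_0^{1\times n}(\mathbb{Z})$, $(\mathcal{A}_\varepsilon\boldsymbol{v})(\gamma)=\sum_{\alpha\in\mathbb{Z}}v(\alpha)A(\varepsilon+2\gamma-\alpha)$, $\gamma\in\mathbb{Z}$. Space $V_k$ and its basis: $V_k\subset\ell_0^{1\times n}(\mathbb{Z})$ is the span of $$\{(\nabla^k\boldsymbol{\delta}e_j)^T(\cdot-\beta):\ \beta\in[0,N-k],\ j=1,\dots,m\}\ \cup\ \{\boldsymbol{\delta}e_j^T(\cdot-\beta):\ \beta\in[0,N],\ j=m+1,\dots,n\},$$ where $\boldsymbol{\delta}e_j$ is the vector sequence equal to $e_j$ at $0$ and $0$ elsewhere. This set is a basis of $V_k$, and $V_k$ is invariant under $\mathcal{A}_0$ and $\mathcal{A}_1$. (In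 the scalar case $n=m=1$ the basis is $\{\nabla^k\boldsymbol{\delta}(\cdot-\beta):\beta\in[0,N-k]\}$.) Matrix convention: the matrix $A_\varepsilon|_{V_k}$ is indexed by this basis, and its row corresponding to a basis element $b$ consists of the coordinates of $\mathcal{A}_\varepsilon b$ in this basis. *)

theory Defs
  imports "HOL-Analysis.Analysis" "HOL-Library.Function_Algebras" "HOL-Library.Groups_Big_Fun"
begin

text \<open>Pointwise real vector space structure on functions; needed to use \<open>span\<close> and
  \<open>representation\<close> for sequences. Addition and zero come from \<open>HOL-Library.Function_Algebras\<close>.\<close>

instantiation "fun" :: (type, scaleR) scaleR
begin

definition "r *\<^sub>R f = (\<lambda>x. r *\<^sub>R f x)"

instance ..

end

instance "fun" :: (type, real_vector) real_vector
  by standard (auto simp: scaleR_fun_def fun_eq_iff algebra_simps)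

text \<open>
  The dimension \<open>n\<close> is \<open>CARD('n)\<close>; the linear order on the index type numbers the coordinates,
  the position of \<open>j\<close> (counted from 1) being \<open>card {..j}\<close>. Column and row
  vectors of length \<open>n\<close> both have type \<open>real ^ 'n\<close>, so transposition of vectors is invisible.
  Sums over all integers with finitely many nonzero terms are written with \<open>Sum_any\<close>
  (which is 0 if infinitely many terms are nonzero; this does not occur for finitely supported
  masks).
\<close>

type_synonym 'n vseq = "int \<Rightarrow> real ^ 'n"
type_synonym 'n mask = "int \<Rightarrow> real ^ 'n ^ 'n"

definition subdivision :: "'n::finite mask \<Rightarrow> 'n vseq \<Rightarrow> 'n vseq" where
  "subdivision M c = (\<lambda>\<alpha>. Sum_any (\<lambda>\<beta>. M (\<alpha> - 2 * \<beta>) *v c \<beta>))"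

definition fixed_space :: "'n::finite mask \<Rightarrow> (real ^ 'n) set" where
  "fixed_space A = {v. \<forall>\<epsilon>\<in>{0, 1}. Sum_any (\<lambda>\<alpha>. A (\<epsilon> - 2 * \<alpha>) *v v) = v}"

definition difference :: "nat \<Rightarrow> 'n::{finite,linorder} vseq \<Rightarrow> 'n vseq" where
  "difference m c =
     (\<lambda>\<alpha>. \<chi> j. if card {..j} \<le> m then - (c \<alpha> $ j) + c (\<alpha> - 1) $ j else c \<alpha> $ j)"

text \<open>\<open>infnorm\<close> is the maximum norm on \<open>real ^ 'n\<close>. The supremum is used
  for bounded sequences only.\<close>

definition seq_norm :: "'n::finite vseq \<Rightarrow> real" where
  "seq_norm c = (SUP \<alpha>. infnorm (c \<alpha>))"

text \<open>\<open>B\<close> finitely supported makes the set below bounded above, and \<open>CARD('n) > 0\<close> makes it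
  nonempty, so this real supremum is the genuine one.\<close>

definition restricted_norm ::
    "nat \<Rightarrow> nat \<Rightarrow> 'n::{finite,linorder} mask \<Rightarrow> nat \<Rightarrow> real" where
  "restricted_norm m k B r =
     Sup {seq_norm ((subdivision B ^^ r) ((difference m ^^ k) c)) / seq_norm ((difference m ^^ k) c) | c.
            bounded (range c) \<and> (difference m ^^ k) c \<noteq> 0}"

definition row_operator :: "'n::finite mask \<Rightarrow> int \<Rightarrow> 'n vseq \<Rightarrow> 'n vseq" where
  "row_operator A \<epsilon> v = (\<lambda>\<gamma>. Sum_any (\<lambda>\<alpha>. v \<alpha> v* A (\<epsilon> + 2 * \<gamma> - \<alpha>)))"

definition delta_seq :: "'n::finite \<Rightarrow> 'n vseq" where
  "delta_seq j = (\<lambda>\<alpha>. if \<alpha> = 0 then axis j 1 else 0)"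

definition V_basis :: "nat \<Rightarrow> nat \<Rightarrow> nat \<Rightarrow> 'n::{finite,linorder} vseq set" where
  "V_basis N m k =
     {(\<lambda>\<alpha>. (difference m ^^ k) (delta_seq j) (\<alpha> - \<beta>)) | \<beta> j.
        \<beta> \<in> {0..int N - int k} \<and> card {..j} \<le> m} \<union>
     {(\<lambda>\<alpha>. delta_seq j (\<alpha> - \<beta>)) | \<beta> j. \<beta> \<in> {0..int N} \<and> m < card {..j}}"

text \<open>Matrices are indexed by the basis elements themselves. The space \<open>V\<^sub>k\<close> is
  \<open>span (V_basis N m k)\<close>; row \<open>b\<close> consists of the coordinates
  of the image of \<open>b\<close>. The function \<open>representation\<close> returns these coordinates because
  \<open>V_basis N m k\<close> is linearly independent and its span is invariant under
  \<open>row_operator A \<epsilon>\<close> (for \<open>\<epsilon> \<in> {0, 1}\<close>) whenever a difference mask for \<open>A\<close> exists.\<close>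

definition V_matrix ::
    "'n::{finite,linorder} mask \<Rightarrow> nat \<Rightarrow> nat \<Rightarrow> nat \<Rightarrow> int \<Rightarrow> 'n vseq \<Rightarrow> 'n vseq \<Rightarrow> real" where
  "V_matrix A N m k \<epsilon> b b' = representation (V_basis N m k) (row_operator A \<epsilon> b) b'"

definition mat_times :: "'i set \<Rightarrow> ('i \<Rightarrow> 'i \<Rightarrow> real) \<Rightarrow> ('i \<Rightarrow> 'i \<Rightarrow> real) \<Rightarrow> 'i \<Rightarrow> 'i \<Rightarrow> real" where
  "mat_times I P Q = (\<lambda>i j. \<Sum>l\<in>I. P i l * Q l j)"

definition mat_prod :: "'i set \<Rightarrow> ('i \<Rightarrow> 'i \<Rightarrow> real) list \<Rightarrow> 'i \<Rightarrow> 'i \<Rightarrow> real" where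
  "mat_prod I Ps = foldr (mat_times I) Ps (\<lambda>i j. if i = j then 1 else 0)"

definition row_sum_norm :: "'i set \<Rightarrow> ('i \<Rightarrow> 'i \<Rightarrow> real) \<Rightarrow> real" where
  "row_sum_norm I P = Max ((\<lambda>i. \<Sum>j\<in>I. \<bar>P i j\<bar>) ` I)"

end

theory Submission
  imports Defs
begin

text \<open>
  Write \<open>D\<close> for the \<open>k\<close>-fold difference \<open>\<nabla>\<^sup>k\<close>. The basis of \<open>V\<^sub>k\<close> consists of the sequences \<open>D u\<close>
  where \<open>u\<close> runs through shifted unit sequences, indexed by pairs \<open>(j, \<beta>)\<close> called slots here.
  Testing \<open>D S\<^sub>A = S\<^sub>B D\<close> on unit sequences shows that the operator \<open>\<A>\<^sub>\<epsilon>\<close> maps \<open>D u\<close> to \<open>D q\<close>, where \<open>q\<close>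
  is a row of the difference mask read along a residue class modulo 2
  (\<open>row_operator_basis_seq\<close>). The support of \<open>A\<close> keeps \<open>D q\<close> inside \<open>{0..N}\<close>, and a finitely
  supported sequence is zero wherever its differences force it to be constant, so \<open>q\<close> is supported
  on the slots (\<open>row_seq_support\<close>). Hence \<open>V\<^sub>k\<close> is invariant and the matrix of \<open>\<A>\<^sub>\<epsilon>\<close> has
  the entries \<open>B (\<epsilon> + 2 * \<beta>' - \<beta>) $ j $ j'\<close> (\<open>V_matrix_basis_seq\<close>).

  The same entries govern subdivision with \<open>B\<close>: if \<open>x = \<epsilon>\<^sub>1 + 2 \<epsilon>\<^sub>2 + \<dots> + 2\<^bsup>r-1\<^esup> \<epsilon>\<^sub>r + 2\<^sup>r y\<close>,
  then the values of \<open>S\<^sub>B\<^sup>r d\<close> in the window of slots at \<open>x\<close> are the product of the matrices for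
  \<open>\<epsilon>\<^sub>1, \<dots>, \<epsilon>\<^sub>r\<close> applied to the values of \<open>d\<close> in the window at \<open>y\<close>
  (\<open>funpow_subdivision_slot\<close>). Since every integer \<open>x\<close> has such an expansion, the maximal absolute row
  sum bounds the restricted norm. For the reverse inequality the window of \<open>d = D c\<close> should carry the
  signs of a maximal row while \<open>d\<close> stays bounded by one. Extending the signs
  antiperiodically to all integers gives such a \<open>d\<close>, and on antiperiodic sequences the difference
  operator is invertible, so \<open>d = D c\<close> with \<open>c\<close> antiperiodic and therefore bounded
  (\<open>exists_difference_with_signs\<close>). For \<open>d\<close> the row sum is attained.
\<close>

section \<open>Iterated differences\<close>

lemma difference_component:
  "difference m c \<alpha> $ j = (if card {..j} \<le> m then - (c \<alpha> $ j) + c (\<alpha> - 1) $ j else c \<alpha> $ j)"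
  by (simp add: difference_def)

text \<open>
  A convolution form of the iterate, used to move differences across the sums in the subdivision
  and row operators. What matters there is that one set of weights serves every sequence and every
  position; the weights are signed binomial coefficients for the differenced components and
  a unit impulse for the others.
\<close>
lemma funpow_difference_stencil:
  "\<exists>w. \<forall>(c :: 'n::{finite,linorder} vseq) \<alpha> j.
     (difference m ^^ k) c \<alpha> $ j = (\<Sum>i\<le>k. w j i * c (\<alpha> - int i) $ j)"
proof (induction k)
  case 0
  show ?case by (intro exI[of _ "\<lambda>_ _. 1"]) auto
next
  case (Suc k)
  then obtain w where w: "\<And>(c :: 'n vseq) \<alpha> j.
      (difference m ^^ k) c \<alpha> $ j = (\<Sum>i\<le>k. w j i * c (\<alpha> - int i) $ j)"
    by blast
  define w' where "w' j i = (if card {..j} \<le> m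
      then (if i \<le> k then - w j i else 0) + (if i = 0 then 0 else w j (i - 1))
      else (if i \<le> k then w j i else 0))" for j :: 'n and i
  have "(difference m ^^ Suc k) c \<alpha> $ j = (\<Sum>i\<le>Suc k. w' j i * c (\<alpha> - int i) $ j)"
    for c :: "'n vseq" and \<alpha> j
  proof (cases "card {..j} \<le> m")
    case True
    have "(\<Sum>i\<le>Suc k. w' j i * c (\<alpha> - int i) $ j)
        = (\<Sum>i\<le>Suc k. (if i \<le> k then - w j i else 0) * c (\<alpha> - int i) $ j)
        + (\<Sum>i\<le>Suc k. (if i = 0 then 0 else w j (i - 1)) * c (\<alpha> - int i) $ j)"
      unfolding sum.distrib[symmetric] using True
      by (intro sum.cong) (auto simp: w'_def algebra_simps)
    also have "(\<Sum>i\<le>Suc k. (if i \<le> k then - w j i else 0) * c (\<alpha> - int i) $ j)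
        = - (difference m ^^ k) c \<alpha> $ j"
      unfolding w sum_negf[symmetric] by (simp add: sum_negf)
    also have "(\<Sum>i\<le>Suc k. (if i = 0 then 0 else w j (i - 1)) * c (\<alpha> - int i) $ j)
        = (difference m ^^ k) c (\<alpha> - 1) $ j"
      unfolding w sum.atMost_Suc_shift by (simp add: algebra_simps)
    finally show ?thesis
      using True by (simp add: difference_component)
  qed (simp add: difference_component w w'_def)
  then show ?case by blast
qed

lemma linear_funpow_difference:
  "linear (difference m ^^ k :: 'n::{finite,linorder} vseq \<Rightarrow> 'n vseq)"
proof (induction k)
  case (Suc k)
  have "linear (difference m :: 'n vseq \<Rightarrow> 'n vseq)"
    by (rule linearI)
      (auto simp: difference_def fun_eq_iff vec_eq_iff scaleR_fun_def algebra_simps)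
  from linear_compose[OF Suc this] show ?case by (simp add: comp_def)
qed (simp add: linear_iff)

lemma funpow_difference_shift:
  "(difference m ^^ k) (\<lambda>\<alpha>. c (\<alpha> - \<beta>)) = (\<lambda>\<alpha>. (difference m ^^ k) c (\<alpha> - \<beta>))"
  by (induction k) (auto simp: difference_def fun_eq_iff vec_eq_iff algebra_simps)

lemma funpow_difference_bounded:
  fixes c :: "'n::{finite,linorder} vseq"
  assumes "bounded (range c)"
  shows "\<exists>C. \<forall>\<alpha> j. \<bar>(difference m ^^ k) c \<alpha> $ j\<bar> \<le> C"
proof (induction k)
  case 0
  from assms obtain C where "norm (c \<alpha>) \<le> C" for \<alpha> by (auto simp: bounded_iff)
  then show ?case by (auto intro!: exI[of _ C] order_trans[OF component_le_norm_cart])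
next
  case (Suc k)
  then obtain C where C: "\<And>\<alpha> j. \<bar>(difference m ^^ k) c \<alpha> $ j\<bar> \<le> C" by blast
  have "\<bar>(difference m ^^ Suc k) c \<alpha> $ j\<bar> \<le> 2 * C" for \<alpha> j
    using C[of \<alpha> j] C[of "\<alpha> - 1" j] by (auto simp: difference_component abs_le_iff)
  then show ?case by blast
qed

text \<open>
  A finitely supported sequence is recovered from where its first difference vanishes: it is
  constant on each of the two rays outside the support of the difference, hence zero there. The
  right end moves by one because \<open>p (b + 1) = p b\<close> carries the zero from \<open>b + 1\<close> back to \<open>b\<close>.
\<close>
lemma eq_0_of_eventually_constant:
  fixes p :: "int \<Rightarrow> real"
  assumes fin: "finite {x. p x \<noteq> 0}"
    and step: "\<And>x. x \<notin> {a..b} \<Longrightarrow> p (x - 1) = p x"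
    and x: "x \<notin> {a..b - 1}"
  shows "p x = 0"
proof (rule ccontr)
  assume nz: "p x \<noteq> 0"
  \<comment> \<open>a walk from \<open>x\<close> away from the interval\<close>
  define f where "f n = (if x < a then x - int n else x + int n)" for n
  have "p (f n) = p x" for n
  proof (induction n)
    case (Suc n)
    have "p (f (Suc n)) = p (f n)"
    proof (cases "x < a")
      case True
      then show ?thesis using step[of "x - int n"] by (simp add: f_def algebra_simps)
    next
      case False
      then show ?thesis using x step[of "x + int n + 1"] by (simp add: f_def algebra_simps)
    qed
    with Suc show ?case by simp
  qed (simp add: f_def)
  then have "range f \<subseteq> {x. p x \<noteq> 0}" using nz by auto
  moreover have "inj f" by (auto simp: inj_def f_def)
  ultimately show False using fin by (meson finite_subset infinite_UNIV_nat finite_imageD)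
qed

lemma funpow_difference_support:
  fixes c :: "'n::{finite,linorder} vseq"
  assumes "\<And>\<alpha>. \<alpha> \<notin> {a..b} \<Longrightarrow> c \<alpha> $ j = 0"
    and "\<alpha> \<notin> {a..b + (if card {..j} \<le> m then int k else 0)}"
  shows "(difference m ^^ k) c \<alpha> $ j = 0"
  using assms(2)
proof (induction k arbitrary: \<alpha>)
  case (Suc k)
  then show ?case
    using Suc.IH[of \<alpha>] Suc.IH[of "\<alpha> - 1"] by (auto simp: difference_component split: if_splits)
qed (use assms(1) in \<open>auto split: if_splits\<close>)

lemma finite_support_difference:
  fixes c :: "'n::{finite,linorder} vseq"
  assumes "finite {\<alpha>. c \<alpha> \<noteq> 0}"
  shows "finite {\<alpha>. difference m c \<alpha> \<noteq> 0}"
proof (rule finite_subset)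
  show "{\<alpha>. difference m c \<alpha> \<noteq> 0} \<subseteq> {\<alpha>. c \<alpha> \<noteq> 0} \<union> (\<lambda>\<alpha>. \<alpha> + 1) ` {\<alpha>. c \<alpha> \<noteq> 0}"
  proof (rule subsetI, rule ccontr)
    fix \<alpha> assume *: "\<alpha> \<in> {\<alpha>. difference m c \<alpha> \<noteq> 0}"
      "\<alpha> \<notin> {\<alpha>. c \<alpha> \<noteq> 0} \<union> (\<lambda>\<alpha>. \<alpha> + 1) ` {\<alpha>. c \<alpha> \<noteq> 0}"
    then have "c \<alpha> = 0" "c (\<alpha> - 1) = 0" by (auto simp: image_iff dest: spec[of _ "\<alpha> - 1"])
    with * show False by (simp add: difference_component vec_eq_iff cong: if_cong)
  qed
qed (use assms in auto)

text \<open>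
  The converse to \<open>funpow_difference_support\<close>, valid for finitely supported sequences only
  (constants have zero difference). It is what confines the image of a basis element to the
  slots of the basis, and with an empty interval it says that iterated differences are injective
  on finitely supported sequences.
\<close>
lemma support_of_funpow_difference:
  fixes c :: "'n::{finite,linorder} vseq"
  assumes "finite {\<alpha>. c \<alpha> \<noteq> 0}"
    and "\<And>\<alpha>. \<alpha> \<notin> {a..b} \<Longrightarrow> (difference m ^^ k) c \<alpha> $ j = 0"
    and "\<alpha> \<notin> {a..b - (if card {..j} \<le> m then int k else 0)}"
  shows "c \<alpha> $ j = 0"
  using assms
proof (induction k arbitrary: c \<alpha>)
  case (Suc k)
  define b' where "b' = b - (if card {..j} \<le> m then int k else 0)"
  have *: "difference m c \<alpha> $ j = 0" if "\<alpha> \<notin> {a..b'}" for \<alpha>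
    using that Suc.IH[of "difference m c" \<alpha>] Suc.prems(1,2)
    by (simp add: funpow_swap1 b'_def finite_support_difference del: atLeastAtMost_iff)
  show ?case
  proof (cases "card {..j} \<le> m")
    case True
    have "finite {\<alpha>. c \<alpha> $ j \<noteq> 0}"
      by (rule finite_subset[OF _ Suc.prems(1)]) auto
    moreover have "c (\<alpha> - 1) $ j = c \<alpha> $ j" if "\<alpha> \<notin> {a..b'}" for \<alpha>
      using *[OF that] True by (simp add: difference_def)
    ultimately show ?thesis
      by (rule eq_0_of_eventually_constant) (use Suc.prems(3) True in \<open>auto simp: b'_def\<close>)
  next
    case False
    then show ?thesis using *[of \<alpha>] Suc.prems(3) by (simp add: difference_def b'_def)
  qed
qed (auto split: if_splits)

section \<open>Bounded sequences with prescribed differences\<close>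

text \<open>
  Antiperiodic sequences form a space of bounded sequences on which the difference operator is
  onto: the only constant among them is zero, so there is no obstruction to summation as there is
  for periodic or merely bounded sequences. Any finite pattern extends to an antiperiodic
  sequence without increasing its absolute values.
\<close>
definition antiperiodic :: "int \<Rightarrow> (int \<Rightarrow> 'a::uminus) \<Rightarrow> bool" where
  "antiperiodic L c \<longleftrightarrow> (\<forall>x. c (x + L) = - c x)"

text \<open>
  If \<open>s\<close> is the moving sum of \<open>d\<close> over one antiperiod \<open>L\<close>, then
  \<open>s (x - 1) - s x = d (x - L) - d x = - 2 * d x\<close>, so \<open>- s / 2\<close> solves the difference equation.
\<close>
lemma antiperiodic_difference_preimage:
  fixes d :: "'n::{finite,linorder} vseq"
  assumes "antiperiodic (int L) d"
  shows "\<exists>c. antiperiodic (int L) c \<and> difference m c = d"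
proof -
  have per: "d (x + int L) $ j = - d x $ j" for x j
    using assms by (simp add: antiperiodic_def)
  define s where "s x j = (\<Sum>i<L. d (x - int i) $ j)" for x j
  define c where "c = (\<lambda>\<alpha>. \<chi> j. if card {..j} \<le> m then - (s \<alpha> j / 2) else d \<alpha> $ j)"
  have "s (x + int L) j = - s x j" for x j
  proof -
    have "d (x + int L - int i) $ j = - d (x - int i) $ j" for i
      using per[of "x - int i"] by (simp add: algebra_simps)
    then show ?thesis by (simp add: s_def sum_negf)
  qed
  then have "antiperiodic (int L) c"
    by (auto simp: antiperiodic_def c_def vec_eq_iff per)
  moreover have "s (x - 1) j - s x j = - 2 * d x $ j" for x j
  proof -
    have "s (x - 1) j - s x j = (\<Sum>i<L. d (x - int (Suc i)) $ j - d (x - int i) $ j)"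
      by (simp add: s_def sum_subtractf algebra_simps)
    also have "\<dots> = d (x - int L) $ j - d x $ j"
      by (subst sum_lessThan_telescope) simp
    also have "\<dots> = - 2 * d x $ j"
      using per[of "x - int L" j] by simp
    finally show ?thesis .
  qed
  then have "difference m c = d"
    by (auto simp: difference_def c_def fun_eq_iff vec_eq_iff field_simps)
  ultimately show ?thesis by blast
qed

lemma antiperiodic_funpow_difference_preimage:
  fixes d :: "'n::{finite,linorder} vseq"
  assumes "antiperiodic (int L) d"
  shows "\<exists>c. antiperiodic (int L) c \<and> (difference m ^^ k) c = d"
  using assms
proof (induction k arbitrary: d)
  case (Suc k)
  then show ?case
    by (metis antiperiodic_difference_preimage comp_apply funpow.simps(2))
qed auto

lemma antiperiodic_mult:
  fixes c :: "int \<Rightarrow> 'a::group_add"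
  assumes "antiperiodic L c"
  shows "c (x + L * z) = (if even z then c x else - c x)"
proof (induction z rule: int_induct[of _ 0])
  case (step1 i)
  then show ?case using assms[unfolded antiperiodic_def, rule_format, of "x + L * i"]
    by (auto simp: algebra_simps)
next
  case (step2 i)
  then show ?case using assms[unfolded antiperiodic_def, rule_format, of "x + L * (i - 1)"]
    by (auto simp: algebra_simps)
qed simp

lemma antiperiodic_bounded:
  fixes c :: "int \<Rightarrow> 'a::real_normed_vector"
  assumes "antiperiodic L c" "L > 0"
  shows "bounded (range c)"
proof -
  have "c x \<in> c ` {0..<L} \<union> (\<lambda>x. - c x) ` {0..<L}" for x
    using antiperiodic_mult[OF assms(1), of "x mod L" "x div L"] \<open>L > 0\<close>
    by (cases "even (x div L)") (auto simp: image_iff intro!: bexI[of _ "x mod L"])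
  then have "range c \<subseteq> c ` {0..<L} \<union> (\<lambda>x. - c x) ` {0..<L}" by blast
  then show ?thesis
    by (meson finite_Un finite_atLeastLessThan_int finite_imageI finite_imp_bounded finite_subset)
qed

lemma antiperiodic_extension:
  fixes L :: int and g :: "int \<Rightarrow> 'a::group_add"
  assumes "L > 0"
  shows "antiperiodic L (\<lambda>x. if even (x div L) then g (x mod L) else - g (x mod L))"
  using assms by (simp add: antiperiodic_def)

text \<open>
  Extended antiperiodically from the window to all integers, a sign pattern keeps absolute value
  one and becomes an iterated difference of a bounded sequence. This makes the restricted norm see
  the absolute row sums of the matrices: restricting the subdivision operator to differences
  costs nothing.
  The window runs backwards because the coordinate belonging to \<open>(j, \<beta>)\<close> will be
  multiplied by the value at \<open>y - \<beta>\<close>.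
\<close>
lemma exists_difference_with_signs:
  fixes s :: "'n::{finite,linorder} \<times> int \<Rightarrow> real"
  assumes s: "\<And>i. \<bar>s i\<bar> = 1"
  shows "\<exists>c :: 'n vseq. bounded (range c) \<and> (\<forall>\<alpha> j. \<bar>(difference m ^^ k) c \<alpha> $ j\<bar> = 1) \<and>
     (\<forall>j. \<forall>\<beta>\<in>{0..int N}. (difference m ^^ k) c (int N - \<beta>) $ j = s (j, \<beta>))"
proof -
  let ?L = "int (Suc N)"
  define g :: "'n vseq" where "g t = (\<chi> j. s (j, int N - t))" for t
  define d where "d x = (if even (x div ?L) then g (x mod ?L) else - g (x mod ?L))" for x
  have "antiperiodic ?L d"
    using antiperiodic_extension[of ?L g] unfolding d_def by simp
  then obtain c where c: "antiperiodic ?L c" "(difference m ^^ k) c = d"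
    using antiperiodic_funpow_difference_preimage by blast
  have "\<bar>d \<alpha> $ j\<bar> = 1" for \<alpha> j by (simp add: d_def g_def s)
  moreover have "d (int N - \<beta>) $ j = s (j, \<beta>)" if "\<beta> \<in> {0..int N}" for \<beta> j
  proof -
    have "(int N - \<beta>) div ?L = 0" "(int N - \<beta>) mod ?L = int N - \<beta>"
      using that by (auto intro: div_pos_pos_trivial mod_pos_pos_trivial)
    then show ?thesis by (simp add: d_def g_def)
  qed
  ultimately show ?thesis
    using antiperiodic_bounded[OF c(1)] c(2) by (intro exI[of _ c]) simp
qed

section \<open>The basis of differences\<close>

text \<open>
  A basis element of \<open>V\<^sub>k\<close> is determined by its component \<open>j\<close> and its shift \<open>\<beta>\<close>. Iterated
  differences of shifted unit sequences cover both families in the definition of the basis, since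
  they leave the components beyond the \<open>m\<close>-th alone; only the range of shifts differs.
\<close>
definition slots :: "nat \<Rightarrow> nat \<Rightarrow> nat \<Rightarrow> ('n::{finite,linorder} \<times> int) set" where
  "slots N m k = (SIGMA j:UNIV. {0..int N - (if card {..j} \<le> m then int k else 0)})"

definition unit_seq :: "'n::finite \<times> int \<Rightarrow> 'n vseq" where
  "unit_seq i = (\<lambda>\<alpha>. delta_seq (fst i) (\<alpha> - snd i))"

abbreviation basis_seq :: "nat \<Rightarrow> nat \<Rightarrow> 'n::{finite,linorder} \<times> int \<Rightarrow> 'n vseq" where
  "basis_seq m k i \<equiv> (difference m ^^ k) (unit_seq i)"

lemma finite_slots: "finite (slots N m k)"
  by (simp add: slots_def)

lemma slots_subset: "slots N m k \<subseteq> UNIV \<times> {0..int N}"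
  by (auto simp: slots_def split: if_splits)

lemma unit_seq_component: "unit_seq i \<alpha> $ l = (if i = (l, \<alpha>) then 1 else 0)"
  by (cases i) (auto simp: unit_seq_def delta_seq_def axis_def)

lemma basis_seq_support:
  assumes "i \<in> slots N m k" "\<alpha> \<notin> {0..int N}"
  shows "basis_seq m k i \<alpha> = 0"
proof (subst vec_eq_iff, rule allI)
  fix l
  show "basis_seq m k i \<alpha> $ l = 0 $ l"
    unfolding zero_index
  proof (rule funpow_difference_support)
    show "unit_seq i \<alpha> $ l = 0"
      if "\<alpha> \<notin> {0..int N - (if card {..l} \<le> m then int k else 0)}" for \<alpha>
      using that assms(1) by (auto simp: unit_seq_component slots_def)
  qed (use assms(2) in auto)
qed

lemma sum_apply: "(\<Sum>i\<in>I. (f i :: 'a \<Rightarrow> 'b::comm_monoid_add)) x = (\<Sum>i\<in>I. f i x)"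
  by (induction I rule: infinite_finite_induct) auto

lemma sum_unit_seq_component:
  assumes "finite I"
  shows "(\<Sum>i\<in>I. f i *\<^sub>R unit_seq i) \<alpha> $ l = (if (l, \<alpha>) \<in> I then f (l, \<alpha>) else 0)"
proof -
  have "(\<Sum>i\<in>I. f i *\<^sub>R unit_seq i) \<alpha> $ l = (\<Sum>i\<in>I. if i = (l, \<alpha>) then f i else 0)"
    unfolding sum_apply sum_component
    by (intro sum.cong) (auto simp: scaleR_fun_def unit_seq_component)
  with assms show ?thesis by simp
qed

lemma V_basis_eq: "V_basis N m k = basis_seq m k ` (slots N m k :: ('n::{finite,linorder} \<times> int) set)"
proof -
  have unchanged: "(difference m ^^ k) (delta_seq j) = delta_seq j" if "m < card {..j}" for j :: 'n
  proof (induction k)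
    case (Suc k)
    have "difference m (delta_seq j) = delta_seq j"
      using that by (auto simp: difference_def delta_seq_def fun_eq_iff vec_eq_iff axis_def)
    with Suc show ?case by simp
  qed simp
  have b: "basis_seq m k (j, \<beta>) = (\<lambda>\<alpha>. (difference m ^^ k) (delta_seq j) (\<alpha> - \<beta>))" for j :: 'n and \<beta>
    by (simp add: unit_seq_def funpow_difference_shift)
  have "v \<in> V_basis N m k \<longleftrightarrow> (\<exists>j \<beta>. (j, \<beta>) \<in> slots N m k \<and> v = basis_seq m k (j, \<beta>))" for v :: "'n vseq"
  proof
    assume "v \<in> V_basis N m k"
    then show "\<exists>j \<beta>. (j, \<beta>) \<in> slots N m k \<and> v = basis_seq m k (j, \<beta>)"
      unfolding V_basis_def
    proof (elim UnE CollectE exE conjE)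
      fix \<beta> and j :: 'n
      assume "v = (\<lambda>\<alpha>. (difference m ^^ k) (delta_seq j) (\<alpha> - \<beta>))"
        and "\<beta> \<in> {0..int N - int k}" "card {..j} \<le> m"
      then show ?thesis by (intro exI[of _ j] exI[of _ \<beta>]) (simp add: slots_def b)
    next
      fix \<beta> and j :: 'n
      assume "v = (\<lambda>\<alpha>. delta_seq j (\<alpha> - \<beta>))" and "\<beta> \<in> {0..int N}" "m < card {..j}"
      then show ?thesis
        by (intro exI[of _ j] exI[of _ \<beta>]) (simp add: slots_def b unchanged)
    qed
  next
    assume "\<exists>j \<beta>. (j, \<beta>) \<in> slots N m k \<and> v = basis_seq m k (j, \<beta>)"
    then obtain j \<beta> where j\<beta>: "(j, \<beta>) \<in> slots N m k" and v: "v = basis_seq m k (j, \<beta>)" by blast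
    show "v \<in> V_basis N m k"
    proof (cases "card {..j} \<le> m")
      case True
      then show ?thesis
        unfolding V_basis_def v b using j\<beta> by (intro UnI1) (auto simp: slots_def)
    next
      case False
      then show ?thesis
        unfolding V_basis_def v b using j\<beta> by (intro UnI2 CollectI exI[of _ j] exI[of _ \<beta>]) (auto simp: slots_def unchanged)
    qed
  qed
  then show ?thesis by (auto simp: image_iff)
qed

text \<open>
  The combination is the iterated difference of the finitely supported sequence with values
  \<open>f\<close>, and iterated differences are injective on such sequences.
\<close>
lemma sum_basis_seq_eq_0:
  fixes f :: "'n::{finite,linorder} \<times> int \<Rightarrow> real"
  assumes "finite I" "(\<Sum>i\<in>I. f i *\<^sub>R basis_seq m k i) = 0" "i \<in> I"
  shows "f i = 0"
proof -
  let ?c = "\<Sum>i\<in>I. f i *\<^sub>R unit_seq i"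
  interpret linear "difference m ^^ k :: 'n vseq \<Rightarrow> 'n vseq" by (rule linear_funpow_difference)
  have "{\<alpha>. ?c \<alpha> \<noteq> 0} \<subseteq> snd ` I"
    using sum_unit_seq_component[OF assms(1), of f] by (force simp: vec_eq_iff split: if_splits)
  then have fin: "finite {\<alpha>. ?c \<alpha> \<noteq> 0}"
    using assms(1) finite_subset by blast
  have z: "(difference m ^^ k) ?c = 0"
    using assms(2) by (simp add: sum scale)
  have "?c (snd i) $ fst i = 0"
    by (rule support_of_funpow_difference[OF fin, of 0 "-1" k m "fst i"]) (auto simp: z)
  with assms show ?thesis by (simp add: sum_unit_seq_component)
qed

lemma inj_on_basis_seq: "inj_on (basis_seq m k) (I :: ('n::{finite,linorder} \<times> int) set)"
proof (rule inj_onI, rule ccontr)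
  fix i i' :: "'n \<times> int" assume *: "basis_seq m k i = basis_seq m k i'" "i \<noteq> i'"
  \<comment> \<open>a coincidence between two basis elements would be a nontrivial relation\<close>
  define f :: "'n \<times> int \<Rightarrow> real" where "f = (\<lambda>l. if l = i then 1 else - 1)"
  have "(\<Sum>l\<in>{i, i'}. f l *\<^sub>R basis_seq m k l) = 0"
    using * by (simp add: f_def)
  then have "f i = 0" by (rule sum_basis_seq_eq_0[rotated]) auto
  then show False by (simp add: f_def)
qed

lemma independent_V_basis: "independent (V_basis N m k :: 'n::{finite,linorder} vseq set)"
proof (rule independent_if_scalars_zero)
  show "finite (V_basis N m k :: 'n vseq set)"
    by (simp add: V_basis_eq finite_slots)
next
  fix f :: "'n vseq \<Rightarrow> real" and v :: "'n vseq"
  assume "(\<Sum>v\<in>V_basis N m k. f v *\<^sub>R v) = 0" "v \<in> V_basis N m k"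
  then show "f v = 0"
    unfolding V_basis_eq sum.reindex[OF inj_on_basis_seq]
    using sum_basis_seq_eq_0[OF finite_slots, of "f \<circ> basis_seq m k" k m N m k] by auto
qed

section \<open>Row operators and the difference mask\<close>

lemma Sum_any_component:
  fixes f :: "'a \<Rightarrow> real ^ 'n"
  assumes "finite F" "{x. f x \<noteq> 0} \<subseteq> F"
  shows "Sum_any f $ j = (\<Sum>x\<in>F. f x $ j)"
  using assms by (simp add: Sum_any.expand_superset)

text \<open>
  The image of the shifted unit sequence \<open>i\<close> under the row operator of \<open>B\<close>.
\<close>
definition row_seq :: "'n::finite mask \<Rightarrow> int \<Rightarrow> 'n \<times> int \<Rightarrow> 'n vseq" where
  "row_seq B \<epsilon> i = (\<lambda>\<gamma>. B (\<epsilon> + 2 * \<gamma> - snd i) $ fst i)"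

text \<open>
  The intertwining relation for subdivision passes to the transposed operators: on basis
  elements, \<open>\<A>\<^sub>\<epsilon> \<nabla>\<^sup>k = \<nabla>\<^sup>k \<B>\<^sub>\<epsilon>\<close>, where \<open>\<B>\<^sub>\<epsilon>\<close> is the row operator of
  \<open>B\<close>. The proof reads the component \<open>l\<close> of the left side as a value of
  \<open>\<nabla>\<^sup>k S\<^sub>A \<delta>e\<^sub>l\<close>, exchanges it for \<open>S\<^sub>B \<nabla>\<^sup>k \<delta>e\<^sub>l\<close>, and reads the result
  backwards.
\<close>
lemma row_operator_basis_seq:
  fixes A B :: "'n::{finite,linorder} mask"
  assumes B: "\<And>c :: 'n vseq. (difference m ^^ k) (subdivision A c) = subdivision B ((difference m ^^ k) c)"
  shows "row_operator A \<epsilon> (basis_seq m k i) = (difference m ^^ k) (row_seq B \<epsilon> i)"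
proof -
  obtain j \<beta> where i: "i = (j, \<beta>)" by (cases i)
  obtain w where w: "\<And>(c :: 'n vseq) \<alpha> j.
      (difference m ^^ k) c \<alpha> $ j = (\<Sum>s\<le>k. w j s * c (\<alpha> - int s) $ j)"
    using funpow_difference_stencil[where ?'n = 'n] by blast
  have basis: "basis_seq m k (j', \<beta>') \<alpha> $ l
      = (if l = j' \<and> \<alpha> \<in> (\<lambda>s. \<beta>' + int s) ` {..k} then w j' (nat (\<alpha> - \<beta>')) else 0)" for j' l \<beta>' \<alpha>
  proof -
    have "basis_seq m k (j', \<beta>') \<alpha> $ l = (\<Sum>s\<le>k. if l = j' \<and> \<alpha> = \<beta>' + int s then w j' s else 0)"
      unfolding w by (intro sum.cong) (auto simp: unit_seq_component)
    also have "\<dots> = (\<Sum>s\<in>{s. s \<le> k \<and> l = j' \<and> \<alpha> = \<beta>' + int s}. w j' s)"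
      by (simp add: sum.inter_filter[symmetric])
    also have "{s. s \<le> k \<and> l = j' \<and> \<alpha> = \<beta>' + int s}
        = (if l = j' \<and> \<alpha> \<in> (\<lambda>s. \<beta>' + int s) ` {..k} then {nat (\<alpha> - \<beta>')} else {})"
      by auto
    finally show ?thesis by simp
  qed
  show ?thesis
  proof (rule ext, subst vec_eq_iff, rule allI)
    fix \<gamma> and l :: 'n
    let ?x = "\<epsilon> + 2 * \<gamma> - \<beta>"
    have "row_operator A \<epsilon> (basis_seq m k i) \<gamma> $ l
        = (\<Sum>\<alpha>\<in>(\<lambda>s. \<beta> + int s) ` {..k}. (basis_seq m k i \<alpha> v* A (\<epsilon> + 2 * \<gamma> - \<alpha>)) $ l)"
      unfolding row_operator_def
      by (rule Sum_any_component)
        (auto simp: i vec_eq_iff vector_matrix_mult_def basis intro: sum.neutral)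
    also have "\<dots> = (\<Sum>s\<le>k. (basis_seq m k i (\<beta> + int s) v* A (\<epsilon> + 2 * \<gamma> - (\<beta> + int s))) $ l)"
      by (subst sum.reindex) (auto simp: inj_on_def)
    also have "\<dots> = (\<Sum>s\<le>k. w j s * A (?x - int s) $ j $ l)"
    proof (rule sum.cong)
      fix s assume "s \<in> {..k}"
      then have *: "basis_seq m k i (\<beta> + int s) $ l' = (if l' = j then w j s else 0)" for l'
        unfolding i basis by auto
      then show "(basis_seq m k i (\<beta> + int s) v* A (\<epsilon> + 2 * \<gamma> - (\<beta> + int s))) $ l
          = w j s * A (?x - int s) $ j $ l"
        by (simp add: vector_matrix_mult_def * diff_diff_eq if_distrib[of "\<lambda>x. x * _"] cong: if_cong)
    qed simp
    also have "\<dots> = (difference m ^^ k) (subdivision A (unit_seq (l, 0))) ?x $ j"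
    proof -
      have "subdivision A (unit_seq (l, 0)) x $ j = A x $ j $ l" for x
      proof -
        have "subdivision A (unit_seq (l, 0)) x
            = (\<Sum>\<gamma>\<in>{0}. A (x - 2 * \<gamma>) *v unit_seq (l, 0) \<gamma>)"
          unfolding subdivision_def
          by (rule Sum_any.expand_superset)
            (auto simp: unit_seq_def delta_seq_def split: if_splits)
        then show ?thesis
          by (simp add: matrix_vector_mult_def unit_seq_component if_distrib cong: if_cong)
      qed
      then show ?thesis by (simp add: w)
    qed
    also have "\<dots> = subdivision B (basis_seq m k (l, 0)) ?x $ j"
      by (simp add: B)
    also have "\<dots> = (\<Sum>\<gamma>'\<in>(\<lambda>s. int s) ` {..k}. (B (?x - 2 * \<gamma>') *v basis_seq m k (l, 0) \<gamma>') $ j)"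
      unfolding subdivision_def
      by (rule Sum_any_component)
        (auto simp: vec_eq_iff matrix_vector_mult_def basis intro: sum.neutral)
    also have "\<dots> = (\<Sum>s\<le>k. (B (?x - 2 * int s) *v basis_seq m k (l, 0) (int s)) $ j)"
      by (subst sum.reindex) (auto simp: inj_on_def)
    also have "\<dots> = (\<Sum>s\<le>k. w l s * row_seq B \<epsilon> i (\<gamma> - int s) $ l)"
    proof (rule sum.cong)
      fix s assume "s \<in> {..k}"
      then have *: "basis_seq m k (l, 0) (int s) $ l' = (if l' = l then w l s else 0)" for l'
        unfolding basis by auto
      then show "(B (?x - 2 * int s) *v basis_seq m k (l, 0) (int s)) $ j
          = w l s * row_seq B \<epsilon> i (\<gamma> - int s) $ l"
        by (simp add: matrix_vector_mult_def row_seq_def i * algebra_simps if_distrib[of "\<lambda>x. x * _"] cong: if_cong)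
    qed simp
    finally show "row_operator A \<epsilon> (basis_seq m k i) \<gamma> $ l
        = (difference m ^^ k) (row_seq B \<epsilon> i) \<gamma> $ l"
      by (simp add: w)
  qed
qed

text \<open>
  The interval \<open>{0..N}\<close> is preserved because \<open>\<epsilon> + 2 * \<gamma>\<close> must lie in \<open>{0..2 * N}\<close>.
\<close>
lemma row_operator_support:
  fixes A :: "'n::finite mask"
  assumes A_supp: "\<And>\<alpha>. \<alpha> \<notin> {0..int N} \<Longrightarrow> A \<alpha> = 0"
    and v: "\<And>\<alpha>. \<alpha> \<notin> {0..int N} \<Longrightarrow> v \<alpha> = 0"
    and "\<epsilon> \<in> {0, 1}" "\<gamma> \<notin> {0..int N}"
  shows "row_operator A \<epsilon> v \<gamma> = 0"
proof -
  have "v \<alpha> v* A (\<epsilon> + 2 * \<gamma> - \<alpha>) = 0" for \<alpha>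
  proof (cases "\<alpha> \<in> {0..int N}")
    case True
    then have "A (\<epsilon> + 2 * \<gamma> - \<alpha>) = 0"
      using assms(3,4) by (intro A_supp) auto
    then show ?thesis by (simp add: vector_matrix_mult_def vec_eq_iff)
  qed (simp add: v)
  then show ?thesis by (simp add: row_operator_def)
qed

section \<open>Matrix products and iterated subdivision\<close>

lemma mat_prod_reindex:
  assumes "inj_on \<Phi> I"
    and "\<And>\<epsilon> i i'. \<epsilon> \<in> set es \<Longrightarrow> i \<in> I \<Longrightarrow> i' \<in> I \<Longrightarrow> P \<epsilon> (\<Phi> i) (\<Phi> i') = Q \<epsilon> i i'"
    and "i \<in> I" "i' \<in> I"
  shows "mat_prod (\<Phi> ` I) (map P es) (\<Phi> i) (\<Phi> i') = mat_prod I (map Q es) i i'"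
  using assms(2-4)
proof (induction es arbitrary: i)
  case Nil
  then show ?case using assms(1) by (auto simp: mat_prod_def inj_on_def)
next
  case (Cons \<epsilon> es)
  then show ?case
    by (auto simp: mat_prod_def mat_times_def sum.reindex[OF assms(1)] intro!: sum.cong)
qed

lemma int_binary_expansion:
  "\<exists>es y. length es = r \<and> set es \<subseteq> {0, 1} \<and> (x::int) = horner_sum (\<lambda>\<epsilon>. \<epsilon>) 2 es + 2 ^ r * y"
proof (induction r arbitrary: x)
  case (Suc r)
  from Suc[of "x div 2"] obtain es y
    where "length es = r" "set es \<subseteq> {0, 1}" "x div 2 = horner_sum (\<lambda>\<epsilon>. \<epsilon>) 2 es + 2 ^ r * y" by blast
  moreover have "x = x mod 2 + 2 * (x div 2)" "x mod 2 \<in> {0, 1}" by auto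
  ultimately show ?case
    by (intro exI[of _ "x mod 2 # es"] exI[of _ y]) (auto simp: algebra_simps)
qed simp

lemma finite_mask_vimage:
  fixes B :: "'n::finite mask"
  assumes "finite {\<alpha>. B \<alpha> \<noteq> 0}"
  shows "finite {\<gamma>. B (\<alpha> - 2 * \<gamma>) \<noteq> 0}"
proof -
  have "inj (\<lambda>\<gamma>. \<alpha> - 2 * \<gamma>)" by (auto simp: inj_def)
  from finite_vimageI[OF assms this] show ?thesis by (simp add: vimage_def)
qed

lemma subdivision_component:
  fixes B :: "'n::finite mask"
  assumes "finite {\<alpha>. B \<alpha> \<noteq> 0}" "finite F" "\<And>\<gamma>. \<gamma> \<notin> F \<Longrightarrow> B (\<alpha> - 2 * \<gamma>) $ j = 0"
  shows "subdivision B c \<alpha> $ j = (\<Sum>\<gamma>\<in>F. \<Sum>l\<in>UNIV. B (\<alpha> - 2 * \<gamma>) $ j $ l * c \<gamma> $ l)"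
proof -
  \<comment> \<open>outside \<open>F\<close> only row \<open>j\<close> of the mask is known to vanish, so the vector-valued sum needs a larger index set\<close>
  let ?G = "F \<union> {\<gamma>. B (\<alpha> - 2 * \<gamma>) \<noteq> 0}"
  have "finite ?G" using finite_mask_vimage[OF assms(1)] assms(2) by simp
  then have "subdivision B c \<alpha> $ j = (\<Sum>\<gamma>\<in>?G. (B (\<alpha> - 2 * \<gamma>) *v c \<gamma>) $ j)"
    unfolding subdivision_def by (rule Sum_any_component) auto
  also have "\<dots> = (\<Sum>\<gamma>\<in>F. (B (\<alpha> - 2 * \<gamma>) *v c \<gamma>) $ j)"
    using \<open>finite ?G\<close> assms(3)
    by (intro sum.mono_neutral_right) (auto simp: matrix_vector_mult_def)
  finally show ?thesis by (simp add: matrix_vector_mult_def)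
qed

locale difference_mask =
  fixes A B :: "'n::{finite,linorder} mask" and N k m :: nat
  assumes A_supp: "\<And>\<alpha>. \<alpha> \<notin> {0..int N} \<Longrightarrow> A \<alpha> = 0"
    and B_supp: "finite {\<alpha>. B \<alpha> \<noteq> 0}"
    and B: "\<And>c :: 'n vseq. (difference m ^^ k) (subdivision A c) = subdivision B ((difference m ^^ k) c)"
begin

text \<open>
  The invariance of \<open>V\<^sub>k\<close>: the image of a basis element is supported in \<open>{0..N}\<close> and is the
  iterated difference of a row sequence of \<open>B\<close>, so that the row sequence lives on the slots.
\<close>
lemma row_seq_support:
  assumes i: "i \<in> slots N m k" and \<epsilon>: "\<epsilon> \<in> {0, 1}" and n: "(l, \<gamma>) \<notin> slots N m k"
  shows "row_seq B \<epsilon> i \<gamma> $ l = 0"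
proof (rule support_of_funpow_difference)
  have "inj (\<lambda>\<gamma>. \<epsilon> + 2 * \<gamma> - snd i)" by (auto simp: inj_def)
  from finite_vimageI[OF B_supp this] show "finite {\<gamma>. row_seq B \<epsilon> i \<gamma> \<noteq> 0}"
    by (rule finite_subset[rotated]) (auto simp: row_seq_def)
next
  fix \<gamma> assume "\<gamma> \<notin> {0..int N}"
  then have "row_operator A \<epsilon> (basis_seq m k i) \<gamma> = 0"
    using A_supp \<epsilon> basis_seq_support[OF i] by (intro row_operator_support) auto
  then show "(difference m ^^ k) (row_seq B \<epsilon> i) \<gamma> $ l = 0"
    by (simp add: row_operator_basis_seq[OF B])
next
  show "\<gamma> \<notin> {0..int N - (if card {..l} \<le> m then int k else 0)}"
    using n by (simp add: slots_def)
qed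

text \<open>
  Expanding the row sequence of \<open>B\<close> in unit sequences and applying the iterated difference
  gives the coordinates: the abstract matrix consists of entries of the difference mask.
\<close>
lemma V_matrix_basis_seq:
  assumes i: "i \<in> slots N m k" and \<epsilon>: "\<epsilon> \<in> {0, 1}" and i': "i' \<in> slots N m k"
  shows "V_matrix A N m k \<epsilon> (basis_seq m k i) (basis_seq m k i') = row_seq B \<epsilon> i (snd i') $ fst i'"
proof -
  let ?I = "slots N m k :: ('n \<times> int) set" and ?V = "V_basis N m k :: 'n vseq set"
  define q where "q i' = row_seq B \<epsilon> i (snd i') $ fst i'" for i'
  \<comment> \<open>coordinates as a function of the basis element itself, the form in which \<open>representation\<close> returns them\<close>
  define f where "f b = (if b \<in> ?V then q (inv_into ?I (basis_seq m k) b) else 0)" for b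
  have f: "f (basis_seq m k i') = q i'" if "i' \<in> ?I" for i'
    using that inv_into_f_f[OF inj_on_basis_seq that] by (simp add: f_def V_basis_eq)
  have finV: "finite ?V" by (simp add: V_basis_eq finite_slots)
  interpret linear "difference m ^^ k :: 'n vseq \<Rightarrow> 'n vseq" by (rule linear_funpow_difference)
  have "row_operator A \<epsilon> (basis_seq m k i) = (difference m ^^ k) (row_seq B \<epsilon> i)"
    by (rule row_operator_basis_seq[OF B])
  also have "row_seq B \<epsilon> i = (\<Sum>i'\<in>?I. q i' *\<^sub>R unit_seq i')"
    using row_seq_support[OF i \<epsilon>]
    by (auto simp: fun_eq_iff vec_eq_iff sum_unit_seq_component[OF finite_slots] q_def)
  also have "(difference m ^^ k) \<dots> = (\<Sum>i'\<in>?I. f (basis_seq m k i') *\<^sub>R basis_seq m k i')"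
    by (simp add: sum scale f)
  also have "\<dots> = (\<Sum>b\<in>?V. f b *\<^sub>R b)"
    by (simp add: V_basis_eq sum.reindex[OF inj_on_basis_seq])
  finally have eq: "row_operator A \<epsilon> (basis_seq m k i) = (\<Sum>b\<in>?V. f b *\<^sub>R b)" .
  have sub: "{b. f b \<noteq> 0} \<subseteq> ?V" by (auto simp: f_def)
  have "representation ?V (row_operator A \<epsilon> (basis_seq m k i)) = f"
  proof (rule real_vector.representation_eqI[OF independent_V_basis])
    show "row_operator A \<epsilon> (basis_seq m k i) \<in> span ?V"
      unfolding eq by (intro span_sum span_scale span_base)
    show "finite {b. f b \<noteq> 0}" using sub finV finite_subset by blast
    show "(\<Sum>b | f b \<noteq> 0. f b *\<^sub>R b) = row_operator A \<epsilon> (basis_seq m k i)"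
      unfolding eq by (rule sum.mono_neutral_left[OF finV sub]) auto
  qed (use sub in auto)
  then show ?thesis using f[OF i'] by (simp add: V_matrix_def q_def)
qed

definition slot_matrix :: "int \<Rightarrow> 'n \<times> int \<Rightarrow> 'n \<times> int \<Rightarrow> real" where
  "slot_matrix \<epsilon> i i' = row_seq B \<epsilon> i (snd i') $ fst i'"

lemma row_sum_norm_V_matrix:
  assumes "set es \<subseteq> {0, 1}"
  shows "row_sum_norm (V_basis N m k) (mat_prod (V_basis N m k) (map (V_matrix A N m k) es))
       = row_sum_norm (slots N m k) (mat_prod (slots N m k) (map slot_matrix es))"
proof -
  have "mat_prod (V_basis N m k) (map (V_matrix A N m k) es) (basis_seq m k i) (basis_seq m k i')
      = mat_prod (slots N m k) (map slot_matrix es) i i'"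
    if "i \<in> slots N m k" "i' \<in> slots N m k" for i i'
    unfolding V_basis_eq
    by (rule mat_prod_reindex[OF inj_on_basis_seq])
      (use assms that V_matrix_basis_seq in \<open>auto simp: slot_matrix_def\<close>)
  then have "(\<Sum>b\<in>V_basis N m k. \<bar>mat_prod (V_basis N m k) (map (V_matrix A N m k) es) (basis_seq m k i) b\<bar>)
      = (\<Sum>i'\<in>slots N m k. \<bar>mat_prod (slots N m k) (map slot_matrix es) i i'\<bar>)"
    if "i \<in> slots N m k" for i
    using that by (simp add: V_basis_eq sum.reindex[OF inj_on_basis_seq])
  then show ?thesis
    by (simp add: row_sum_norm_def V_basis_eq image_image)
qed

text \<open>
  One subdivision step is multiplication by a slot matrix. The vector in question collects the
  values \<open>d (y - \<beta>) $ j\<close> over the slots \<open>(j, \<beta>)\<close>; entries of \<open>B\<close> outside the slots vanish in the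
  relevant rows, so that this window is mapped to the window of the subdivided sequence at
  \<open>\<epsilon> + 2 * y\<close>, whatever \<open>d\<close> is.
\<close>
lemma subdivision_slot:
  assumes i: "i \<in> slots N m k" and \<epsilon>: "\<epsilon> \<in> {0, 1}"
  shows "subdivision B d (\<epsilon> + 2 * y - snd i) $ fst i
       = (\<Sum>i'\<in>slots N m k. slot_matrix \<epsilon> i i' * d (y - snd i') $ fst i')"
proof -
  let ?x = "\<epsilon> + 2 * y - snd i"
  have row: "B (?x - 2 * (y - \<beta>)) $ fst i = row_seq B \<epsilon> i \<beta>" for \<beta>
    unfolding row_seq_def by (rule arg_cong[of _ _ "\<lambda>x. B x $ fst i"]) simp
  have "B (?x - 2 * \<gamma>) $ fst i = 0" if "\<gamma> \<notin> (\<lambda>\<beta>. y - \<beta>) ` {0..int N}" for \<gamma>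
  proof -
    have "y - \<gamma> \<notin> {0..int N}"
      using that by (metis diff_diff_eq2 add_diff_cancel_left' image_eqI)
    then have "row_seq B \<epsilon> i (y - \<gamma>) $ l = 0" for l
      using slots_subset by (intro row_seq_support[OF i \<epsilon>]) blast
    then show ?thesis using row[of "y - \<gamma>"] by (simp add: vec_eq_iff)
  qed
  from subdivision_component[OF B_supp _ this]
  have "subdivision B d ?x $ fst i
      = (\<Sum>\<gamma>\<in>(\<lambda>\<beta>. y - \<beta>) ` {0..int N}. \<Sum>l\<in>UNIV. B (?x - 2 * \<gamma>) $ fst i $ l * d \<gamma> $ l)"
    by blast
  also have "\<dots> = (\<Sum>\<beta>\<in>{0..int N}. \<Sum>l\<in>UNIV. row_seq B \<epsilon> i \<beta> $ l * d (y - \<beta>) $ l)"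
    by (subst sum.reindex) (simp_all only: comp_def row, simp add: inj_on_def)
  also have "\<dots> = (\<Sum>i'\<in>UNIV \<times> {0..int N}. slot_matrix \<epsilon> i i' * d (y - snd i') $ fst i')"
    by (subst sum.swap) (simp add: sum.cartesian_product slot_matrix_def case_prod_beta)
  also have "\<dots> = (\<Sum>i'\<in>slots N m k. slot_matrix \<epsilon> i i' * d (y - snd i') $ fst i')"
    using row_seq_support[OF i \<epsilon>]
    by (intro sum.mono_neutral_right slots_subset) (auto simp: slot_matrix_def)
  finally show ?thesis .
qed

text \<open>
  In \<open>r\<close> steps the parities applied are the last \<open>r\<close> binary digits of the position, least
  significant digit first, which is also the order of the factors in the product.
\<close>
lemma funpow_subdivision_slot:
  assumes "i \<in> slots N m k" "set es \<subseteq> {0, 1}"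
  shows "(subdivision B ^^ length es) d (horner_sum (\<lambda>\<epsilon>. \<epsilon>) 2 es + 2 ^ length es * y - snd i) $ fst i
       = (\<Sum>i'\<in>slots N m k. mat_prod (slots N m k) (map slot_matrix es) i i' * d (y - snd i') $ fst i')"
  using assms
proof (induction es arbitrary: i)
  case Nil
  have "mat_prod (slots N m k) [] i i' * d (y - snd i') $ fst i'
      = (if i' = i then d (y - snd i) $ fst i else 0)" for i'
    by (simp add: mat_prod_def)
  with Nil show ?case by (simp add: finite_slots)
next
  case (Cons \<epsilon> es)
  let ?I = "slots N m k" and ?P = "mat_prod (slots N m k) (map slot_matrix es)"
  let ?y = "horner_sum (\<lambda>\<epsilon>. \<epsilon>) 2 es + 2 ^ length es * y"
  have "horner_sum (\<lambda>\<epsilon>. \<epsilon>) 2 (\<epsilon> # es) + 2 ^ length (\<epsilon> # es) * y = \<epsilon> + 2 * ?y"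
    by (simp add: algebra_simps)
  then have "(subdivision B ^^ length (\<epsilon> # es)) d
        (horner_sum (\<lambda>\<epsilon>. \<epsilon>) 2 (\<epsilon> # es) + 2 ^ length (\<epsilon> # es) * y - snd i) $ fst i
      = subdivision B ((subdivision B ^^ length es) d) (\<epsilon> + 2 * ?y - snd i) $ fst i"
    by (simp only: list.size funpow.simps comp_apply add_0_right add_Suc_right)
  also have "\<dots> = (\<Sum>l\<in>?I. slot_matrix \<epsilon> i l * (subdivision B ^^ length es) d (?y - snd l) $ fst l)"
    using Cons.prems by (intro subdivision_slot) auto
  also have "\<dots> = (\<Sum>l\<in>?I. \<Sum>i'\<in>?I. slot_matrix \<epsilon> i l * ?P l i' * d (y - snd i') $ fst i')"
    using Cons by (intro sum.cong) (auto simp: sum_distrib_left mult.assoc)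
  also have "\<dots> = (\<Sum>i'\<in>?I. mat_prod ?I (map slot_matrix (\<epsilon> # es)) i i' * d (y - snd i') $ fst i')"
    by (subst sum.swap) (simp add: mat_prod_def mat_times_def sum_distrib_right)
  finally show ?case .
qed

end

section \<open>The norm identity\<close>

lemma infnorm_le_cart:
  fixes x :: "real ^ 'n"
  assumes "\<And>j. \<bar>x $ j\<bar> \<le> C"
  shows "infnorm x \<le> C"
  unfolding infnorm_cart by (rule cSup_least) (use assms in auto)

lemma bounded_component_le_seq_norm:
  fixes c :: "'n::finite vseq"
  assumes "\<And>\<alpha> j. \<bar>c \<alpha> $ j\<bar> \<le> C"
  shows "\<bar>c \<alpha> $ j\<bar> \<le> seq_norm c"
proof -
  have "bdd_above (range (\<lambda>\<alpha>. infnorm (c \<alpha>)))"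
    by (rule bdd_aboveI2[of _ _ C]) (auto intro!: infnorm_le_cart assms)
  then have "infnorm (c \<alpha>) \<le> seq_norm c"
    unfolding seq_norm_def by (rule cSUP_upper2) auto
  then show ?thesis using component_le_infnorm_cart[of "c \<alpha>" j] by linarith
qed

lemma seq_norm_le:
  fixes c :: "'n::finite vseq"
  assumes "\<And>\<alpha> j. \<bar>c \<alpha> $ j\<bar> \<le> C"
  shows "seq_norm c \<le> C"
  unfolding seq_norm_def by (rule cSUP_least) (auto intro!: infnorm_le_cart assms)

theorem theorem3p3:
  fixes A B :: "'n::{finite,linorder} mask" and N k m r :: nat
  assumes k: "1 \<le> k" "k < N"
    and A_supp: "\<And>\<alpha>. \<alpha> \<notin> {0..int N} \<Longrightarrow> A \<alpha> = 0"
    and m: "m = dim (fixed_space A)"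
    and B_supp: "finite {\<alpha>. B \<alpha> \<noteq> 0}"
    and B: "\<And>c :: 'n vseq. (difference m ^^ k) (subdivision A c) = subdivision B ((difference m ^^ k) c)"
    and r: "1 \<le> r"
  shows "Max ((\<lambda>\<epsilon>s. row_sum_norm (V_basis N m k) (mat_prod (V_basis N m k) (map (V_matrix A N m k) \<epsilon>s)))
              ` {\<epsilon>s. length \<epsilon>s = r \<and> set \<epsilon>s \<subseteq> {0, 1}})
         = restricted_norm m k B r"
proof -
  interpret difference_mask A B N k m
    using A_supp B_supp B by unfold_locales
  let ?I = "slots N m k :: ('n \<times> int) set"
  let ?E = "{es. length es = r \<and> set es \<subseteq> {0, 1 :: int}}"
  let ?D = "difference m ^^ k :: 'n vseq \<Rightarrow> 'n vseq"
  let ?S = "subdivision B ^^ r"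
  define P where "P es = mat_prod ?I (map slot_matrix es)" for es
  define M where "M = Max ((\<lambda>es. row_sum_norm ?I (P es)) ` ?E)"
  have finE: "finite ?E"
    using finite_lists_length_eq[of "{0, 1 :: int}" r] by (simp add: conj_commute)
  have zero_slot: "(j, 0) \<in> ?I" for j
    using k by (simp add: slots_def)
  have slot: "?S d (horner_sum (\<lambda>\<epsilon>. \<epsilon>) 2 es + 2 ^ r * y - snd i) $ fst i
      = (\<Sum>i'\<in>?I. P es i i' * d (y - snd i') $ fst i')" if "i \<in> ?I" "es \<in> ?E" for i es d y
    using funpow_subdivision_slot[of i es d y] that by (simp add: P_def)
  have le_M: "(\<Sum>i'\<in>?I. \<bar>P es i i'\<bar>) \<le> M" if "i \<in> ?I" "es \<in> ?E" for i es
  proof -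
    have "(\<Sum>i'\<in>?I. \<bar>P es i i'\<bar>) \<le> row_sum_norm ?I (P es)"
      unfolding row_sum_norm_def using that finite_slots by (intro Max_ge) auto
    also have "\<dots> \<le> M"
      unfolding M_def using finE that by (intro Max_ge) auto
    finally show ?thesis .
  qed
  have bound: "\<bar>?S d x $ j\<bar> \<le> M * C" if d: "\<And>\<alpha> j. \<bar>d \<alpha> $ j\<bar> \<le> C" for d C x j
  proof -
    obtain es y where es: "es \<in> ?E" and x: "x = horner_sum (\<lambda>\<epsilon>. \<epsilon>) 2 es + 2 ^ r * y"
      using int_binary_expansion[of r x] by auto
    \<comment> \<open>every value of the subdivided sequence is read off from the row with shift 0\<close>
    have "\<bar>?S d x $ j\<bar> = \<bar>\<Sum>i'\<in>?I. P es (j, 0) i' * d (y - snd i') $ fst i'\<bar>"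
      using slot[OF zero_slot[of j] es, of d y] by (simp add: x)
    also have "\<dots> \<le> (\<Sum>i'\<in>?I. \<bar>P es (j, 0) i'\<bar> * C)"
      by (rule order_trans[OF sum_abs]) (auto simp: abs_mult intro!: sum_mono mult_left_mono d)
    also have "\<dots> \<le> M * C"
      unfolding sum_distrib_right[symmetric]
      using le_M[OF zero_slot es] order_trans[OF abs_ge_zero d] by (intro mult_right_mono) auto
    finally show ?thesis .
  qed
  have upper: "seq_norm (?S (?D c)) / seq_norm (?D c) \<le> M"
    if c: "bounded (range c)" "?D c \<noteq> 0" for c
  proof -
    obtain C where "\<And>\<alpha> j. \<bar>?D c \<alpha> $ j\<bar> \<le> C"
      using funpow_difference_bounded[OF c(1)] by blast
    then have le: "\<bar>?D c \<alpha> $ j\<bar> \<le> seq_norm (?D c)" for \<alpha> j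
      by (rule bounded_component_le_seq_norm)
    from c(2) obtain \<alpha> j where "?D c \<alpha> $ j \<noteq> 0"
      by (auto simp: fun_eq_iff vec_eq_iff)
    then have pos: "seq_norm (?D c) > 0" using le[of \<alpha> j] by linarith
    from bound[OF le] have "seq_norm (?S (?D c)) \<le> M * seq_norm (?D c)" by (rule seq_norm_le)
    with pos show ?thesis by (simp add: divide_le_eq)
  qed
  have attained: "\<exists>c. bounded (range c) \<and> ?D c \<noteq> 0 \<and> M \<le> seq_norm (?S (?D c)) / seq_norm (?D c)"
  proof -
    have "replicate r 0 \<in> ?E" by auto
    then have "?E \<noteq> {}" by blast
    then have "M \<in> (\<lambda>es. row_sum_norm ?I (P es)) ` ?E"
      unfolding M_def using finE by (intro Max_in) auto
    then obtain es where es: "es \<in> ?E" and "M = row_sum_norm ?I (P es)" by blast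
    moreover have "row_sum_norm ?I (P es) \<in> (\<lambda>i. \<Sum>i'\<in>?I. \<bar>P es i i'\<bar>) ` ?I"
      unfolding row_sum_norm_def using zero_slot by (intro Max_in finite_imageI finite_slots) auto
    ultimately obtain i where i: "i \<in> ?I" and M: "M = (\<Sum>i'\<in>?I. \<bar>P es i i'\<bar>)" by auto
    \<comment> \<open>zero entries also get the sign 1, so that the sequence found below has norm exactly one\<close>
    define s :: "'n \<times> int \<Rightarrow> real" where "s i' = (if P es i i' \<ge> 0 then 1 else - 1)" for i'
    have "\<bar>s i'\<bar> = 1" for i' by (simp add: s_def)
    then obtain c where c: "bounded (range c)" "\<And>\<alpha> j. \<bar>?D c \<alpha> $ j\<bar> = 1"
      "\<And>j \<beta>. \<beta> \<in> {0..int N} \<Longrightarrow> ?D c (int N - \<beta>) $ j = s (j, \<beta>)"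
      using exists_difference_with_signs[of s k m N] by blast
    have nz: "?D c \<noteq> 0"
      using c(2) by (metis abs_zero zero_fun_apply zero_index zero_neq_one)
    have one: "seq_norm (?D c) = 1"
    proof (rule antisym)
      show "seq_norm (?D c) \<le> 1" by (rule seq_norm_le) (simp add: c(2))
      show "1 \<le> seq_norm (?D c)"
        using bounded_component_le_seq_norm[of "?D c" 1 0 "fst i"] by (simp add: c(2))
    qed
    \<comment> \<open>at this position the maximal row meets exactly its own sign pattern\<close>
    let ?x = "horner_sum (\<lambda>\<epsilon>. \<epsilon>) 2 es + 2 ^ r * int N - snd i"
    have "?S (?D c) ?x $ fst i = (\<Sum>i'\<in>?I. P es i i' * ?D c (int N - snd i') $ fst i')"
      by (rule slot[OF i es])
    also have "\<dots> = M"
      unfolding M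
    proof (rule sum.cong)
      fix i' assume "i' \<in> ?I"
      then have "snd i' \<in> {0..int N}" using slots_subset by fastforce
      then show "P es i i' * ?D c (int N - snd i') $ fst i' = \<bar>P es i i'\<bar>"
        using c(3)[of "snd i'" "fst i'"] by (simp add: s_def)
    qed simp
    finally have "M \<le> \<bar>?S (?D c) ?x $ fst i\<bar>" by simp
    also have "\<dots> \<le> seq_norm (?S (?D c))"
      by (rule bounded_component_le_seq_norm[OF bound[where C = 1]]) (simp add: c(2))
    finally show ?thesis using c(1) nz one by auto
  qed
  have "restricted_norm m k B r = M"
    unfolding restricted_norm_def
  proof (rule cSup_eq_maximum)
    from attained obtain c where c: "bounded (range c)" "?D c \<noteq> 0"
      "M \<le> seq_norm (?S (?D c)) / seq_norm (?D c)" by blast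
    with upper[of c] have "M = seq_norm (?S (?D c)) / seq_norm (?D c)" by simp
    with c show "M \<in> {seq_norm (?S (?D c)) / seq_norm (?D c) | c. bounded (range c) \<and> ?D c \<noteq> 0}"
      by blast
  qed (use upper in auto)
  moreover have "Max ((\<lambda>es. row_sum_norm (V_basis N m k) (mat_prod (V_basis N m k) (map (V_matrix A N m k) es))) ` ?E) = M"
    unfolding M_def P_def
    by (rule arg_cong[of _ _ Max], rule image_cong[OF refl]) (simp add: row_sum_norm_V_matrix)
  ultimately show ?thesis by simp
qed

end
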